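(* Let $n$ be a positive integer and let $s\in\mathbb Z$ with $1\le s<n$. Let $|\psi\rangle$ be an $n$-qubit, represented as an element of $\mathrm{QRA}(n)$. Then the element $$\mathrm{SWAP}(s,s+1)=f_sf_s^\dagger f_{s+1}f_{s+1}^\dagger-f_sf_{s+1}^\dagger+f_s^\dagger f_{s+1}+f_s^\dagger f_sf_{s+1}^\dagger f_{s+1}$$ of $\mathrm{QRA}(n)$ acts on $|\psi\rangle$ (by left multiplication) as a SWAP between qubits $s$ and $s+1$.
   Context: Quantum Register Algebra. Let $\mathbb G_{2n+2}$ be the real Clifford (geometric) algebra of positive definite signature with generators $e_1,\dots,e_{2n},r_1,r_2$ (each squares to $1$, distinct ones anticommute), let $\iota=r_1r_2$ (so $\iota^2=-1$ and $\iota$ commutes with every $e_j$), and let $\tilde{\mathbb C}=\{a+b\iota : a,b\in\mathbb R\}$. $\mathrm{QRA}(n)$ is the algebra of all $\tilde{\mathbb C}$-linear combinations of elements of the subalgebra $\mathbb G_{2n}$ generated by $e_1,\dots,e_{2n}$. For $i=1,\dots,n$ put $$f_i=\tfrac12(e_i+\iota e_{i+n}),\qquad f_i^\dagger=\tfrac12(e_i-\iota e_{i+n}),\qquad I=f_1f_1^\dagger\cdots f_nf_n^\dagger .$$ The computational basis state $|a_1\dots a_n\rangle$, $a_i\in\{0,1\}$, is identified with $(f_1^\dagger)^{a_1}\cdots(f_n^\dagger)^{a_n}I$, and an $n$-qubit is an element $\sum_{a\in\{0,1\}^n}\psi_{a_1\dots a_n}(f_1^\dagger)^{a_1}\cdots(f_n^\dagger)^{a_n}I$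 with $\psi_{a_1\dots a_n}\in\tilde{\mathbb C}$. Gates act on $n$-qubits by left multiplication in $\mathrm{QRA}(n)$. An element acts as a SWAP between qubits $s$ and $t$ if left multiplication by it sends each basis state $|a_1\dots a_n\rangle$ to the basis state obtained by interchanging $a_s$ and $a_t$ (extended $\tilde{\mathbb C}$-linearly to all $n$-qubits). *)

theory Defs
  imports Complex_Main "HOL-Library.FuncSet"
begin

section \<open>The Clifford algebra of positive definite signature\<close>

text \<open>
  Multivectors over countably many orthonormal generators, in blade coordinates: the value at
  a finite set \<open>A = {i\<^sub>1 < \<dots> < i\<^sub>k}\<close> is the coefficient of the blade
  \<open>gen i\<^sub>1 * \<dots> * gen i\<^sub>k\<close>.  Each multivector involves finitely many generators only, and the
  Clifford algebra on a finite set \<open>U\<close> of generators is the subalgebra generated by \<open>gen ` U\<close>;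
  its elements are those with all coefficients outside \<open>Pow U\<close> equal to zero
  (\<open>generated_algebra_gen\<close> below), so that its dimension is \<open>2 ^ card U\<close>.
\<close>

typedef clifford = "{f :: nat set \<Rightarrow> real. \<exists>U. finite U \<and> (\<forall>A. f A \<noteq> 0 \<longrightarrow> A \<subseteq> U)}"
  morphisms coeff Abs_clifford
  by (rule exI[of _ "\<lambda>_. 0"]) auto

setup_lifting type_definition_clifford

text \<open>
  Sorting the product of the blades \<open>A\<close> and \<open>B\<close> takes one transposition, hence one change of
  sign, for each pair below; the generators common to \<open>A\<close> and \<open>B\<close> then square to \<open>1\<close>, which
  leaves the blade \<open>sym_diff A B\<close>.
\<close>

definition blade_sign :: "nat set \<Rightarrow> nat set \<Rightarrow> real" where
  "blade_sign A B = (- 1) ^ card {(a, b). a \<in> A \<and> b \<in> B \<and> b < a}"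

lemma sym_diff_cancel: "sym_diff A (sym_diff A B) = B"
  by auto

lemma sym_diff_assoc: "sym_diff (sym_diff A B) C = sym_diff A (sym_diff B C)"
  by auto

lemma blade_sign_eq_prod:
  assumes "finite A" "finite B"
  shows "blade_sign A B = (\<Prod>a\<in>A. \<Prod>b\<in>B. if b < a then - 1 else 1)"
proof -
  have *: "{(a, b). a \<in> A \<and> b \<in> B \<and> b < a} = {p \<in> A \<times> B. snd p < fst p}"
    by auto
  have "(\<Prod>a\<in>A. \<Prod>b\<in>B. if b < a then - 1 else (1::real))
      = (\<Prod>p\<in>A \<times> B. if snd p < fst p then - 1 else 1)"
    by (simp add: prod.cartesian_product case_prod_beta)
  also have "\<dots> = (\<Prod>p\<in>{p \<in> A \<times> B. snd p < fst p}. - 1)"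
    using assms by (subst prod.inter_filter) auto
  finally show ?thesis
    by (simp add: blade_sign_def *)
qed

lemma prod_sym_diff:
  fixes h :: "'a \<Rightarrow> real"
  assumes "finite A" "finite B" "\<And>x. h x * h x = 1"
  shows "prod h (sym_diff A B) = prod h A * prod h B"
proof -
  have A: "prod h A = prod h (A - B) * prod h (A \<inter> B)"
    using assms by (subst prod.union_disjoint[symmetric]) (auto intro!: prod.cong)
  have B: "prod h B = prod h (B - A) * prod h (A \<inter> B)"
    using assms by (subst prod.union_disjoint[symmetric]) (auto intro!: prod.cong)
  have "prod h (A \<inter> B) * prod h (A \<inter> B) = 1"
    using assms by (simp flip: prod.distrib)
  moreover have "prod h (sym_diff A B) = prod h (A - B) * prod h (B - A)"
    using assms by (subst prod.union_disjoint) auto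
  ultimately show ?thesis
    unfolding A B by (metis (no_types, lifting) mult.assoc mult.left_commute mult.right_neutral)
qed

lemma blade_sign_sym_diff_left:
  assumes "finite A" "finite B" "finite C"
  shows "blade_sign (sym_diff A B) C = blade_sign A C * blade_sign B C"
  using assms by (simp add: blade_sign_eq_prod, intro prod_sym_diff)
    (auto simp flip: prod.distrib intro!: prod.neutral)

lemma blade_sign_sym_diff_right:
  assumes "finite A" "finite B" "finite C"
  shows "blade_sign A (sym_diff B C) = blade_sign A B * blade_sign A C"
  using assms by (simp add: blade_sign_eq_prod flip: prod.distrib, intro prod.cong refl prod_sym_diff)
    auto

lemma blade_sign_empty [simp]: "blade_sign {} A = 1" "blade_sign A {} = 1"
  by (simp_all add: blade_sign_def)

lemma coeff_bound2:
  assumes "\<exists>U. finite U \<and> (\<forall>A. f A \<noteq> (0::real) \<longrightarrow> A \<subseteq> U)"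
    and "\<exists>U. finite U \<and> (\<forall>A. g A \<noteq> (0::real) \<longrightarrow> A \<subseteq> U)"
  obtains U where "finite U" "\<And>A. f A \<noteq> 0 \<Longrightarrow> A \<subseteq> U" "\<And>A. g A \<noteq> 0 \<Longrightarrow> A \<subseteq> (U :: nat set)"
proof -
  from assms obtain U V where "finite U" "\<forall>A. f A \<noteq> 0 \<longrightarrow> A \<subseteq> U"
    "finite V" "\<forall>A. g A \<noteq> 0 \<longrightarrow> A \<subseteq> V" by auto
  then show thesis by (intro that[of "U \<union> V"]) auto
qed

instantiation clifford :: real_algebra_1
begin

lift_definition zero_clifford :: clifford is "\<lambda>_. 0"
  by auto

lift_definition one_clifford :: clifford is "\<lambda>A. if A = {} then 1 else 0"
  by (rule exI[of _ "{}"]) auto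

lift_definition plus_clifford :: "clifford \<Rightarrow> clifford \<Rightarrow> clifford" is "\<lambda>f g A. f A + g A"
  by (erule (1) coeff_bound2) (metis add.right_neutral)

lift_definition uminus_clifford :: "clifford \<Rightarrow> clifford" is "\<lambda>f A. - f A"
  by simp

lift_definition minus_clifford :: "clifford \<Rightarrow> clifford \<Rightarrow> clifford" is "\<lambda>f g A. f A - g A"
  by (erule (1) coeff_bound2) (metis diff_zero)

lift_definition scaleR_clifford :: "real \<Rightarrow> clifford \<Rightarrow> clifford" is "\<lambda>c f A. c * f A"
  by (metis mult_zero_right)

text \<open>The bilinear extension of \<open>blade A * blade B = blade_sign A B *\<^sub>R blade (sym_diff A B)\<close>;
  the coefficient at \<open>C\<close> collects the pairs with \<open>sym_diff A B = C\<close>, that is,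
  \<open>B = sym_diff A C\<close>.\<close>

lift_definition times_clifford :: "clifford \<Rightarrow> clifford \<Rightarrow> clifford" is
  "\<lambda>f g C. \<Sum>A | f A \<noteq> 0. blade_sign A (sym_diff A C) * f A * g (sym_diff A C)"
proof -
  fix f g :: "nat set \<Rightarrow> real"
  assume "\<exists>U. finite U \<and> (\<forall>A. f A \<noteq> 0 \<longrightarrow> A \<subseteq> U)" "\<exists>U. finite U \<and> (\<forall>A. g A \<noteq> 0 \<longrightarrow> A \<subseteq> U)"
  then obtain U where U: "finite U" "\<And>A. f A \<noteq> 0 \<Longrightarrow> A \<subseteq> U" "\<And>A. g A \<noteq> 0 \<Longrightarrow> A \<subseteq> U"
    using coeff_bound2[of f g] by blast
  show "\<exists>U. finite U \<and> (\<forall>C. (\<Sum>A | f A \<noteq> 0. blade_sign A (sym_diff A C) * f A *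
    g (sym_diff A C)) \<noteq> 0 \<longrightarrow> C \<subseteq> U)"
  proof (intro exI[of _ U] conjI allI impI)
    fix C assume "(\<Sum>A | f A \<noteq> 0. blade_sign A (sym_diff A C) * f A * g (sym_diff A C)) \<noteq> 0"
    then obtain A where "f A \<noteq> 0" "g (sym_diff A C) \<noteq> 0"
      by (metis (mono_tags, lifting) mem_Collect_eq mult_zero_right sum.not_neutral_contains_not_neutral)
    then have "A \<subseteq> U" "sym_diff A C \<subseteq> U" using U by auto
    then show "C \<subseteq> U" by blast
  qed (fact U)
qed

lemma times_coeff:
  assumes "finite U" "\<And>A. coeff x A \<noteq> 0 \<Longrightarrow> A \<subseteq> U"
  shows "coeff (x * y) C
    = (\<Sum>A\<in>Pow U. blade_sign A (sym_diff A C) * coeff x A * coeff y (sym_diff A C))"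
  using assms by (auto simp: times_clifford.rep_eq intro!: sum.mono_neutral_left)

lemma clifford_bound2:
  obtains U where "finite U" "\<And>A. coeff x A \<noteq> 0 \<Longrightarrow> A \<subseteq> U" "\<And>A. coeff y A \<noteq> 0 \<Longrightarrow> A \<subseteq> U"
  using coeff_bound2[of "coeff x" "coeff y"] coeff[of x] coeff[of y] by auto

lemma clifford_bound: "\<exists>U. finite U \<and> (\<forall>A. coeff x A \<noteq> 0 \<longrightarrow> A \<subseteq> U)"
  using coeff[of x] by simp

lemma times_coeff_subset:
  assumes "\<And>A. coeff x A \<noteq> 0 \<Longrightarrow> A \<subseteq> U" "\<And>A. coeff y A \<noteq> 0 \<Longrightarrow> A \<subseteq> U" "coeff (x * y) C \<noteq> 0"
  shows "C \<subseteq> U"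
proof -
  obtain A where "coeff x A \<noteq> 0" "coeff y (sym_diff A C) \<noteq> 0"
    using assms(3) by (auto simp: times_clifford.rep_eq elim!: sum.not_neutral_contains_not_neutral)
  then have "A \<subseteq> U" "sym_diff A C \<subseteq> U" using assms by auto
  then show ?thesis by blast
qed

lemma clifford_mult_assoc: "(x * y) * z = x * (y * z)" for x y z :: clifford
proof -
  obtain U1 where U1: "finite U1" "\<And>A. coeff x A \<noteq> 0 \<Longrightarrow> A \<subseteq> U1" "\<And>A. coeff y A \<noteq> 0 \<Longrightarrow> A \<subseteq> U1"
    using clifford_bound2[of x y] by blast
  obtain U2 where U2: "finite U2" "\<forall>A. coeff z A \<noteq> 0 \<longrightarrow> A \<subseteq> U2"
    using clifford_bound[of z] by blast
  define U where "U = U1 \<union> U2"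
  have U: "finite U" "\<And>A. coeff x A \<noteq> 0 \<Longrightarrow> A \<subseteq> U" "\<And>A. coeff y A \<noteq> 0 \<Longrightarrow> A \<subseteq> U"
    "\<And>A. coeff z A \<noteq> 0 \<Longrightarrow> A \<subseteq> U"
    using U1 U2 unfolding U_def by blast+
  have Uxy: "\<And>A. coeff (x * y) A \<noteq> 0 \<Longrightarrow> A \<subseteq> U"
    using times_coeff_subset[of x U y] U by blast
  have Uyz: "\<And>A. coeff (y * z) A \<noteq> 0 \<Longrightarrow> A \<subseteq> U"
    using times_coeff_subset[of y U z] U by blast
  have t: "coeff (x * w) C
      = (\<Sum>A\<in>Pow U. blade_sign A (sym_diff A C) * coeff x A * coeff w (sym_diff A C))"
    "coeff (y * w) C
      = (\<Sum>A\<in>Pow U. blade_sign A (sym_diff A C) * coeff y A * coeff w (sym_diff A C))"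
    "coeff ((x * y) * w) C
      = (\<Sum>A\<in>Pow U. blade_sign A (sym_diff A C) * coeff (x * y) A * coeff w (sym_diff A C))" for w C
    using U Uxy by (intro times_coeff; blast)+
  have *: "coeff ((x * y) * z) D = coeff (x * (y * z)) D" for D
  proof (cases "D \<subseteq> U")
    case False
    then show ?thesis
      using times_coeff_subset[of "x * y" U z D] times_coeff_subset[of x U "y * z" D] U Uxy Uyz
      by metis
  next
    case True
    let ?t = "\<lambda>A F. blade_sign A F * blade_sign (sym_diff A F) (sym_diff (sym_diff A F) D) *
      coeff x A * coeff y F * coeff z (sym_diff (sym_diff A F) D)"
    have fin: "finite X" if "X \<subseteq> U" for X using that U(1) finite_subset by blast
    have "coeff ((x * y) * z) D = (\<Sum>E\<in>Pow U. \<Sum>A\<in>Pow U. blade_sign E (sym_diff E D) *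
        (blade_sign A (sym_diff A E) * coeff x A * coeff y (sym_diff A E)) * coeff z (sym_diff E D))"
      by (simp only: t sum_distrib_left sum_distrib_right)
    also have "\<dots> = (\<Sum>A\<in>Pow U. \<Sum>E\<in>Pow U. blade_sign E (sym_diff E D) *
        (blade_sign A (sym_diff A E) * coeff x A * coeff y (sym_diff A E)) * coeff z (sym_diff E D))"
      by (rule sum.swap)
    also have "\<dots> = (\<Sum>A\<in>Pow U. \<Sum>F\<in>Pow U. ?t A F)"
    proof (rule sum.cong[OF refl])
      fix A assume "A \<in> Pow U"
      then show "(\<Sum>E\<in>Pow U. blade_sign E (sym_diff E D) *
        (blade_sign A (sym_diff A E) * coeff x A * coeff y (sym_diff A E)) * coeff z (sym_diff E D))
        = (\<Sum>F\<in>Pow U. ?t A F)"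
        by (intro sum.reindex_bij_witness[of _ "sym_diff A" "sym_diff A"])
           (auto simp only: sym_diff_cancel mult_ac)
    qed
    also have "\<dots> = (\<Sum>A\<in>Pow U. \<Sum>F\<in>Pow U. blade_sign A (sym_diff A D) * coeff x A *
        (blade_sign F (sym_diff F (sym_diff A D)) * coeff y F * coeff z (sym_diff F (sym_diff A D))))"
    proof (intro sum.cong refl)
      fix A F assume AF: "A \<in> Pow U" "F \<in> Pow U"
      let ?C = "sym_diff F (sym_diff A D)"
      have C: "sym_diff (sym_diff A F) D = ?C" by auto
      have AD: "sym_diff A D = sym_diff F ?C" by auto
      have f: "finite A" "finite F" "finite D" using AF True fin by auto
      then have "finite ?C" by auto
      then have "blade_sign A F * blade_sign (sym_diff A F) ?C = blade_sign A (sym_diff A D) * blade_sign F ?C"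
        using blade_sign_sym_diff_left[OF f(1,2), of ?C] blade_sign_sym_diff_right[OF f(1,2), of ?C] AD
        by (metis mult.assoc)
      then show "?t A F = blade_sign A (sym_diff A D) * coeff x A *
        (blade_sign F ?C * coeff y F * coeff z ?C)"
        unfolding C by algebra
    qed
    also have "\<dots> = coeff (x * (y * z)) D"
      by (simp only: t sum_distrib_left)
    finally show ?thesis .
  qed
  show ?thesis using * by (simp add: coeff_inject[symmetric] fun_eq_iff)
qed

instance
proof
  fix x y z :: clifford and a b :: real
  show "x + y + z = x + (y + z)" "x + y = y + x" "0 + x = x" "- x + x = 0" "x - y = x + - y"
    by (transfer, simp add: add_ac)+
  show "a *\<^sub>R (x + y) = a *\<^sub>R x + a *\<^sub>R y" "(a + b) *\<^sub>R x = a *\<^sub>R x + b *\<^sub>R x"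
    "a *\<^sub>R b *\<^sub>R x = (a * b) *\<^sub>R x" "1 *\<^sub>R x = x"
    by (transfer, simp add: algebra_simps)+
  show "x * y * z = x * (y * z)" by (rule clifford_mult_assoc)
  show "(0::clifford) \<noteq> 1" by transfer (metis zero_neq_one)
  obtain U where U: "finite U" "\<And>A. coeff x A \<noteq> 0 \<Longrightarrow> A \<subseteq> U" "\<And>A. coeff y A \<noteq> 0 \<Longrightarrow> A \<subseteq> U"
    using clifford_bound2[of x y] by blast
  have Us: "\<And>A. coeff (x + y) A \<noteq> 0 \<Longrightarrow> A \<subseteq> U" "\<And>A. coeff (a *\<^sub>R x) A \<noteq> 0 \<Longrightarrow> A \<subseteq> U"
    using U by (auto simp: plus_clifford.rep_eq scaleR_clifford.rep_eq) (metis add.right_neutral subsetD)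
  have t: "coeff (x * w) C = (\<Sum>A\<in>Pow U. blade_sign A (sym_diff A C) * coeff x A * coeff w (sym_diff A C))"
    "coeff (y * w) C = (\<Sum>A\<in>Pow U. blade_sign A (sym_diff A C) * coeff y A * coeff w (sym_diff A C))"
    "coeff ((x + y) * w) C
      = (\<Sum>A\<in>Pow U. blade_sign A (sym_diff A C) * coeff (x + y) A * coeff w (sym_diff A C))"
    "coeff (a *\<^sub>R x * w) C
      = (\<Sum>A\<in>Pow U. blade_sign A (sym_diff A C) * coeff (a *\<^sub>R x) A * coeff w (sym_diff A C))" for w C
    using U Us by (intro times_coeff; blast)+
  show "(x + y) * z = x * z + y * z" "x * (y + z) = x * y + x * z"
    "a *\<^sub>R x * y = a *\<^sub>R (x * y)" "x * a *\<^sub>R y = a *\<^sub>R (x * y)"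
    by (simp_all add: coeff_inject[symmetric] fun_eq_iff t plus_clifford.rep_eq scaleR_clifford.rep_eq
        algebra_simps sum.distrib sum_distrib_left)
  show "1 * x = x"
    by (simp add: coeff_inject[symmetric] fun_eq_iff times_clifford.rep_eq one_clifford.rep_eq)
  have "coeff (x * 1) C = coeff x C" for C
  proof -
    have "coeff (x * 1) C = (\<Sum>A\<in>Pow U. if A = C then coeff x A else 0)"
      unfolding t by (intro sum.cong refl) (auto simp: one_clifford.rep_eq)
    also have "\<dots> = coeff x C" using U by auto
    finally show ?thesis .
  qed
  then show "x * 1 = x" by (simp add: coeff_inject[symmetric] fun_eq_iff)
qed

end

lift_definition gen :: "nat \<Rightarrow> clifford" is "\<lambda>i A. if A = {i} then 1 else 0"
  subgoal for i by (rule exI[of _ "{i}"]) auto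
  done

lemma gen_square: "gen i * gen i = 1"
proof -
  have "{(a, b). a \<in> {i} \<and> b \<in> {i} \<and> b < a} = {}" by auto
  then have "blade_sign {i} {i} = 1" by (simp only: blade_sign_def card.empty power_0)
  then show ?thesis
    by (auto simp: coeff_inject[symmetric] fun_eq_iff times_clifford.rep_eq gen.rep_eq
        one_clifford.rep_eq)
qed

lemma gen_anticommute:
  assumes "i \<noteq> j"
  shows "gen i * gen j = - (gen j * gen i)"
proof -
  have p: "coeff (gen k * gen l) C = (if C = {k, l} then (if l < k then - 1 else 1) else 0)"
    if "k \<noteq> l" for k l C
  proof -
    have "coeff (gen k * gen l) C = (if sym_diff {k} C = {l} then blade_sign {k} {l} else 0)"
      by (simp add: times_clifford.rep_eq gen.rep_eq)
    also have "sym_diff {k} C = {l} \<longleftrightarrow> C = sym_diff {k} {l}"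
      using sym_diff_cancel by metis
    also have "sym_diff {k} {l} = {k, l}"
      using that by blast
    also have "{(a, b). a \<in> {k} \<and> b \<in> {l} \<and> b < a} = (if l < k then {(k, l)} else {})"
      by auto
    then have "blade_sign {k} {l} = (if l < k then - 1 else 1)"
      by (simp add: blade_sign_def)
    finally show ?thesis by simp
  qed
  show ?thesis
    using assms by (auto simp: coeff_inject[symmetric] fun_eq_iff p uminus_clifford.rep_eq insert_commute)
qed

inductive_set generated_algebra :: "'a::real_algebra_1 set \<Rightarrow> 'a set" for X where
  base: "x \<in> X \<Longrightarrow> x \<in> generated_algebra X"
| one: "1 \<in> generated_algebra X"
| add: "x \<in> generated_algebra X \<Longrightarrow> y \<in> generated_algebra X \<Longrightarrow> x + y \<in> generated_algebra X"
| scaleR: "x \<in> generated_algebra X \<Longrightarrow> c *\<^sub>R x \<in> generated_algebra X"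
| mult: "x \<in> generated_algebra X \<Longrightarrow> y \<in> generated_algebra X \<Longrightarrow> x * y \<in> generated_algebra X"

lift_definition blade :: "nat set \<Rightarrow> clifford" is
  "\<lambda>A B. if finite A \<and> B = A then 1 else 0"
  subgoal for A by (rule exI[of _ "if finite A then A else {}"]) auto
  done

lemma blade_insert_greatest:
  assumes "finite A" "\<forall>a\<in>A. a < i"
  shows "blade (insert i A) = blade A * gen i"
proof -
  have "coeff (blade A * gen i) C = coeff (blade (insert i A)) C" for C
  proof -
    have "coeff (blade A * gen i) C = (if sym_diff A C = {i} then blade_sign A {i} else 0)"
      using assms by (simp add: times_clifford.rep_eq blade.rep_eq gen.rep_eq)
    also have "sym_diff A C = {i} \<longleftrightarrow> C = insert i A"
      using assms by (auto simp: set_eq_iff)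
    also have "{(a, b). a \<in> A \<and> b \<in> {i} \<and> b < a} = {}"
      using assms by auto
    then have "blade_sign A {i} = 1"
      by (simp only: blade_sign_def card.empty power_0)
    finally show ?thesis using assms by (simp add: blade.rep_eq)
  qed
  then show ?thesis by (simp add: coeff_inject[symmetric] fun_eq_iff)
qed

lemma generated_algebra_gen:
  "generated_algebra (gen ` U) = {x. \<forall>A. coeff x A \<noteq> 0 \<longrightarrow> A \<subseteq> U}"
proof (intro equalityI subsetI)
  fix x assume "x \<in> generated_algebra (gen ` U)"
  then show "x \<in> {x. \<forall>A. coeff x A \<noteq> 0 \<longrightarrow> A \<subseteq> U}"
  proof induction
    case (mult x y)
    then show ?case using times_coeff_subset[of x U y] by blast
  next
    case (add x y)
    then show ?case by (simp add: plus_clifford.rep_eq) (metis add.right_neutral)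
  qed (auto simp: gen.rep_eq one_clifford.rep_eq scaleR_clifford.rep_eq split: if_splits)
next
  fix x assume "x \<in> {x. \<forall>A. coeff x A \<noteq> 0 \<longrightarrow> A \<subseteq> U}"
  then have x: "\<And>A. coeff x A \<noteq> 0 \<Longrightarrow> A \<subseteq> U" by blast
  obtain V where V: "finite V" "\<forall>A. coeff x A \<noteq> 0 \<longrightarrow> A \<subseteq> V"
    using clifford_bound[of x] by blast
  define W where "W = U \<inter> V"
  have W: "finite W" "W \<subseteq> U" "\<And>A. coeff x A \<noteq> 0 \<Longrightarrow> A \<subseteq> W"
    using x V unfolding W_def by auto
  have blade: "A \<subseteq> U \<longrightarrow> blade A \<in> generated_algebra (gen ` U)" if "finite A" for A
    using that
  proof (induction rule: finite_linorder_max_induct)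
    case empty
    have "blade {} = 1" by transfer auto
    then show ?case by (simp add: generated_algebra.one)
  next
    case (insert b A)
    then show ?case
      by (auto simp: blade_insert_greatest intro: generated_algebra.mult generated_algebra.base)
  qed
  have zero: "0 \<in> generated_algebra (gen ` U)"
    using generated_algebra.scaleR[OF generated_algebra.one, of 0] by simp
  have sum: "(\<Sum>A\<in>S. coeff x A *\<^sub>R blade A) \<in> generated_algebra (gen ` U)"
    if "finite S" "S \<subseteq> Pow W" for S
    using that
  proof (induction rule: finite_induct)
    case (insert A S)
    then show ?case using blade[of A] W finite_subset[of A W]
      by (auto intro!: generated_algebra.add generated_algebra.scaleR)
  qed (simp add: zero)
  have coeff_sum: "coeff (sum h S) C = (\<Sum>A\<in>S. coeff (h A) C)" for h :: "nat set \<Rightarrow> clifford" and S C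
    by (induction S rule: infinite_finite_induct)
       (simp_all add: zero_clifford.rep_eq plus_clifford.rep_eq)
  have "coeff x C = coeff (\<Sum>A\<in>Pow W. coeff x A *\<^sub>R blade A) C" for C
  proof -
    have "coeff (\<Sum>A\<in>Pow W. coeff x A *\<^sub>R blade A) C = (\<Sum>A\<in>Pow W. if A = C then coeff x A else 0)"
      unfolding coeff_sum using finite_subset[OF _ W(1)]
      by (intro sum.cong refl) (auto simp: scaleR_clifford.rep_eq blade.rep_eq)
    also have "\<dots> = coeff x C" using W by auto
    finally show ?thesis ..
  qed
  then have "x = (\<Sum>A\<in>Pow W. coeff x A *\<^sub>R blade A)"
    by (intro iffD1[OF coeff_inject] ext)
  then show "x \<in> generated_algebra (gen ` U)"
    using sum[of "Pow W"] W(1) by simp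
qed

section \<open>The quantum register algebra\<close>

text \<open>The generators \<open>r\<^sub>1\<close>, \<open>r\<^sub>2\<close> take the first two indices, so that one choice serves for
  all \<open>n\<close>; \<open>e_gen j\<close> is used for \<open>j \<ge> 1\<close> only.\<close>

definition r1 :: clifford where "r1 = gen 0"
definition r2 :: clifford where "r2 = gen 1"
definition e_gen :: "nat \<Rightarrow> clifford" where "e_gen j = gen (j + 2)"

definition \<iota> :: clifford where "\<iota> = r1 * r2"

definition Ctilde :: "clifford set" where
  "Ctilde = {of_real a + of_real b * \<iota> | a b. True}"

definition QRA :: "nat \<Rightarrow> clifford set" where
  "QRA n = {(\<Sum>k<m. c k * x k) | (m::nat) c x.
     \<forall>k<m. c k \<in> Ctilde \<and> x k \<in> generated_algebra (e_gen ` {1..2 * n})}"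

definition f_op :: "nat \<Rightarrow> nat \<Rightarrow> clifford" where
  "f_op n i = (1 / 2) *\<^sub>R (e_gen i + \<iota> * e_gen (i + n))"

definition f_dag :: "nat \<Rightarrow> nat \<Rightarrow> clifford" where
  "f_dag n i = (1 / 2) *\<^sub>R (e_gen i - \<iota> * e_gen (i + n))"

definition I_vac :: "nat \<Rightarrow> clifford" where
  "I_vac n = (\<Prod>i\<leftarrow>[1..<n + 1]. f_op n i * f_dag n i)"

definition bits :: "nat \<Rightarrow> (nat \<Rightarrow> nat) set" where
  "bits n = {1..n} \<rightarrow>\<^sub>E {0, 1}"

definition ket :: "nat \<Rightarrow> (nat \<Rightarrow> nat) \<Rightarrow> clifford" where
  "ket n a = (\<Prod>i\<leftarrow>[1..<n + 1]. f_dag n i ^ a i) * I_vac n"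

definition qubits :: "nat \<Rightarrow> clifford set" where
  "qubits n = {(\<Sum>a\<in>bits n. \<psi> a * ket n a) | \<psi>. \<forall>a\<in>bits n. \<psi> a \<in> Ctilde}"

definition swap_bits :: "nat \<Rightarrow> nat \<Rightarrow> (nat \<Rightarrow> nat) \<Rightarrow> nat \<Rightarrow> nat" where
  "swap_bits s t a = a(s := a t, t := a s)"

definition swaps_basis_states :: "nat \<Rightarrow> nat \<Rightarrow> nat \<Rightarrow> clifford \<Rightarrow> bool" where
  "swaps_basis_states n s t u \<longleftrightarrow> (\<forall>a\<in>bits n. u * ket n a = ket n (swap_bits s t a))"

text \<open>The action of \<open>u\<close> on the \<open>n\<close>-qubit \<open>x\<close> is the \<open>Ctilde\<close>-linear extension of the swap of
  basis states.  It is stated for every family \<open>\<psi>\<close> of amplitudes of \<open>x\<close>, so it does not rely on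
  their uniqueness.\<close>

definition acts_as_swap_on :: "nat \<Rightarrow> nat \<Rightarrow> nat \<Rightarrow> clifford \<Rightarrow> clifford \<Rightarrow> bool" where
  "acts_as_swap_on n s t u x \<longleftrightarrow>
     (\<forall>\<psi>. (\<forall>a\<in>bits n. \<psi> a \<in> Ctilde) \<longrightarrow> x = (\<Sum>a\<in>bits n. \<psi> a * ket n a) \<longrightarrow>
        u * x = (\<Sum>a\<in>bits n. \<psi> a * ket n (swap_bits s t a)))"

definition swap_gate :: "nat \<Rightarrow> nat \<Rightarrow> clifford" where
  "swap_gate n s =
     f_op n s * f_dag n s * f_op n (s + 1) * f_dag n (s + 1)
     - f_op n s * f_dag n (s + 1)
     + f_dag n s * f_op n (s + 1)
     + f_dag n s * f_op n s * f_dag n (s + 1) * f_op n (s + 1)"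

end

theory Submission
  imports Defs
begin

text \<open>
  The \<open>f_op n i\<close>, \<open>f_dag n i\<close> satisfy the canonical anticommutation relations, and \<open>f_op n i\<close>
  annihilates \<open>I_vac n\<close>.  Every term of the gate is even, so it commutes with the creation
  operators to the left of position \<open>s\<close>, and what lies to the right of position \<open>s + 1\<close> is
  annihilated by \<open>f_op n s\<close> and \<open>f_op n (s + 1)\<close>.  The four values of the two bits then reduce to
  a computation with two anticommuting pairs.  Coefficients in \<open>Ctilde\<close> are central in the quantum
  register algebra, which yields the linear extension.
\<close>

section \<open>Anticommutation relations\<close>

lemma \<iota>_square: "\<iota> * \<iota> = - 1"
proof -
  have "\<iota> * \<iota> = r1 * (r2 * r1) * r2" by (simp add: \<iota>_def mult.assoc)
  also have "r2 * r1 = - (r1 * r2)"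
    unfolding r1_def r2_def by (rule gen_anticommute) simp
  also have "r1 * - (r1 * r2) * r2 = - ((r1 * r1) * (r2 * r2))" by (simp add: mult.assoc)
  finally show ?thesis by (simp add: r1_def r2_def gen_square)
qed

lemma \<iota>_commute_e_gen: "e_gen j * \<iota> = \<iota> * e_gen j"
proof -
  have "e_gen j * r1 = - (r1 * e_gen j)" "e_gen j * r2 = - (r2 * e_gen j)"
    unfolding e_gen_def r1_def r2_def by (rule gen_anticommute; simp)+
  then show ?thesis
    by (metis \<iota>_def minus_mult_commute minus_minus mult.assoc)
qed

lemma e_gen_anticommutator: "e_gen i * e_gen j + e_gen j * e_gen i = (if i = j then 2 else 0)"
  using gen_anticommute[of "i + 2" "j + 2"] by (simp add: e_gen_def gen_square)

definition ladder :: "real \<Rightarrow> nat \<Rightarrow> nat \<Rightarrow> clifford" where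
  "ladder c n i = (1 / 2) *\<^sub>R (e_gen i + c *\<^sub>R (\<iota> * e_gen (i + n)))"

lemma f_op_eq_ladder: "f_op n i = ladder 1 n i"
  and f_dag_eq_ladder: "f_dag n i = ladder (- 1) n i"
  by (simp_all add: f_op_def f_dag_def ladder_def)

lemma ladder_anticommutator:
  assumes "i \<in> {1..n}" "j \<in> {1..n}"
  shows "ladder c n i * ladder d n j + ladder d n j * ladder c n i
    = (if i = j then ((1 - c * d) / 2) *\<^sub>R 1 else 0)"
proof -
  let ?ac = "\<lambda>k l. e_gen k * e_gen l + e_gen l * e_gen k"
  have l: "e_gen k * (\<iota> * e_gen l) = \<iota> * (e_gen k * e_gen l)" for k l
    by (metis \<iota>_commute_e_gen mult.assoc)
  have ll: "\<iota> * (\<iota> * x) = - x" for x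
    by (metis \<iota>_square mult.assoc mult_minus1)
  have "ladder c n i * ladder d n j + ladder d n j * ladder c n i
    = (1 / 4) *\<^sub>R (?ac i j + d *\<^sub>R (\<iota> * ?ac i (j + n)) + c *\<^sub>R (\<iota> * ?ac (i + n) j)
        - (c * d) *\<^sub>R ?ac (i + n) (j + n))"
    by (simp add: ladder_def algebra_simps l ll)
  also have "\<dots> = (1 / 4) *\<^sub>R (if i = j then 2 *\<^sub>R 1 - (c * d) *\<^sub>R 2 *\<^sub>R 1 else 0)"
    using assms by (auto simp: e_gen_anticommutator scaleR_2)
  also have "\<dots> = (if i = j then ((1 - c * d) / 2) *\<^sub>R 1 else 0)"
    by (simp add: diff_divide_distrib flip: scaleR_diff_left)
  finally show ?thesis .
qed

lemma f_op_anticommute: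
  "i \<in> {1..n} \<Longrightarrow> j \<in> {1..n} \<Longrightarrow> i \<noteq> j \<Longrightarrow> f_op n i * f_op n j = - (f_op n j * f_op n i)"
  and f_dag_anticommute:
  "i \<in> {1..n} \<Longrightarrow> j \<in> {1..n} \<Longrightarrow> i \<noteq> j \<Longrightarrow> f_dag n i * f_dag n j = - (f_dag n j * f_dag n i)"
  and f_op_f_dag_anticommute:
  "i \<in> {1..n} \<Longrightarrow> j \<in> {1..n} \<Longrightarrow> i \<noteq> j \<Longrightarrow> f_op n i * f_dag n j = - (f_dag n j * f_op n i)"
  and f_op_f_dag_same: "i \<in> {1..n} \<Longrightarrow> f_op n i * f_dag n i = 1 - f_dag n i * f_op n i"
  using ladder_anticommutator[of i n j] ladder_anticommutator[of i n i 1 "- 1"]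
  by (auto simp: f_op_eq_ladder f_dag_eq_ladder eq_neg_iff_add_eq_0 eq_diff_eq)

lemma f_op_square: "i \<in> {1..n} \<Longrightarrow> f_op n i * f_op n i = 0"
  and f_dag_square: "i \<in> {1..n} \<Longrightarrow> f_dag n i * f_dag n i = 0"
  using ladder_anticommutator[of i n i 1 1] ladder_anticommutator[of i n i "- 1" "- 1"]
  by (simp_all add: f_op_eq_ladder f_dag_eq_ladder flip: scaleR_2)

section \<open>The two-qubit computation\<close>

lemma anticommute_prod_list_pow:
  fixes x :: "'a::ring_1"
  assumes "\<And>i. i \<in> set is \<Longrightarrow> x * g i = - (g i * x)"
  shows "x * (\<Prod>i\<leftarrow>is. g i ^ a i) = (- 1) ^ (\<Sum>i\<leftarrow>is. a i) * ((\<Prod>i\<leftarrow>is. g i ^ a i) * x)"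
  using assms
proof (induction "is")
  case (Cons i "is")
  have pow: "x * g i ^ k = (- 1) ^ k * (g i ^ k * x)" for k
  proof (induction k)
    case (Suc k)
    have "x * g i ^ Suc k = (- 1) ^ k * (g i ^ k * (x * g i))"
      by (simp add: Suc power_Suc2 mult.assoc[symmetric] del: power_Suc)
    then show ?case using Cons.prems[of i]
      by (simp add: power_Suc2 mult.assoc del: power_Suc)
  qed simp
  have c: "(- 1) ^ k * y = y * (- 1) ^ k" for k and y :: 'a
    by (cases "even k") simp_all
  have "x * (\<Prod>i\<leftarrow>i # is. g i ^ a i) = (- 1) ^ a i * (g i ^ a i * (x * (\<Prod>i\<leftarrow>is. g i ^ a i)))"
    by (simp add: pow mult.assoc[symmetric])
  also have "\<dots> = (- 1) ^ a i * (g i ^ a i * ((- 1) ^ (\<Sum>i\<leftarrow>is. a i) * ((\<Prod>i\<leftarrow>is. g i ^ a i) * x)))"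
    using Cons by simp
  also have "\<dots> = (- 1) ^ (\<Sum>i\<leftarrow>i # is. a i) * ((\<Prod>i\<leftarrow>i # is. g i ^ a i) * x)"
    by (metis (no_types, lifting) c list.simps(9) mult.assoc power_add prod_list.Cons sum_list.Cons)
  finally show ?case .
qed simp

lemma commute_prod_list_pow:
  fixes x y :: "'a::ring_1"
  assumes "\<And>i. i \<in> set is \<Longrightarrow> x * g i = - (g i * x)" "\<And>i. i \<in> set is \<Longrightarrow> y * g i = - (g i * y)"
  shows "x * y * (\<Prod>i\<leftarrow>is. g i ^ a i) = (\<Prod>i\<leftarrow>is. g i ^ a i) * (x * y)"
proof -
  let ?k = "\<Sum>i\<leftarrow>is. a i" and ?A = "\<Prod>i\<leftarrow>is. g i ^ a i"
  have "x * y * ?A = x * ((- 1) ^ ?k * (?A * y))"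
    using anticommute_prod_list_pow[of "is" y g a] assms by (simp add: mult.assoc)
  also have "\<dots> = (- 1) ^ ?k * (x * ?A * y)" by (cases "even ?k") (simp_all add: mult.assoc)
  also have "\<dots> = ?A * (x * y)"
    using anticommute_prod_list_pow[of "is" x g a] assms
    by (cases "even ?k") (simp_all add: mult.assoc)
  finally show ?thesis .
qed

lemma f_op_I_vac:
  assumes "i \<in> {1..n}"
  shows "f_op n i * I_vac n = 0"
proof -
  have *: "f_op n i * (\<Prod>j\<leftarrow>is. f_op n j * f_dag n j) = 0"
    if "i \<in> set is" "set is \<subseteq> {1..n}" for "is"
    using that
  proof (induction "is")
    case (Cons j "is")
    show ?case
    proof (cases "j = i")
      case True
      then show ?thesis using assms by (simp add: f_op_square flip: mult.assoc)
    next
      case False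
      have "f_op n i * (f_op n j * f_dag n j) = f_op n j * f_dag n j * f_op n i"
        using assms Cons.prems False
        by (metis (no_types, lifting) f_op_anticommute f_op_f_dag_anticommute insert_subset
            list.simps(15) minus_mult_commute minus_minus mult.assoc)
      then show ?thesis using Cons False
        by (simp add: mult.assoc[symmetric]) (simp add: mult.assoc)
    qed
  qed simp
  have "i \<in> set [1..<n + 1]" "set [1..<n + 1] \<subseteq> {1..n}" using assms by auto
  then show ?thesis unfolding I_vac_def by (rule *)
qed

lemma two_mode_swap:
  fixes f g f' g' v :: "'a::ring_1"
  assumes sq: "f' * f' = 0" "g' * g' = 0"
    and inv: "f * f' = 1 - f' * f" "g * g' = 1 - g' * g"
    and ac: "f * g = - (g * f)" "f' * g' = - (g' * f')" "f * g' = - (g' * f)" "g * f' = - (f' * g)"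
    and vac: "f * v = 0" "g * v = 0"
    and "p \<in> {0, 1}" "q \<in> {0, 1::nat}"
  shows "(f * f' * g * g' - f * g' + f' * g + f' * f * g' * g) * (f' ^ p * (g' ^ q * v))
    = f' ^ q * (g' ^ p * v)"
proof -
  have sq': "f' * (f' * x) = 0" "g' * (g' * x) = 0" for x
    by (simp_all add: sq flip: mult.assoc)
  have inv': "f * (f' * x) = x - f' * (f * x)" "g * (g' * x) = x - g' * (g * x)" for x
    by (simp_all add: inv algebra_simps flip: mult.assoc)
  have ac': "f * (g * x) = - (g * (f * x))" "g' * (f' * x) = - (f' * (g' * x))"
    "f * (g' * x) = - (g' * (f * x))" "g * (f' * x) = - (f' * (g * x))" for x
    using ac by (simp_all flip: mult.assoc)
  show ?thesis
    using assms(11,12) by (auto simp: distrib_right left_diff_distrib right_diff_distrib mult.assoc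
        sq' inv' ac' vac)
qed

lemma upt_split_pair:
  assumes "1 \<le> s" "s < n"
  shows "[1..<n + 1] = [1..<s] @ s # Suc s # [s + 2..<n + 1]"
  using assms by (metis (no_types, lifting) One_nat_def Suc_eq_plus1 add_2_eq_Suc' le_add_diff_inverse
      less_SucI less_or_eq_imp_le not_less_eq upt_add_eq_append upt_conv_Cons)

lemma swap_gate_ket:
  assumes "1 \<le> s" "s < n" "a \<in> bits n"
  shows "swap_gate n s * ket n a = ket n (swap_bits s (s + 1) a)"
proof -
  define A where "A = (\<lambda>a. \<Prod>i\<leftarrow>[1..<s]. f_dag n i ^ a i)"
  define B where "B = (\<lambda>a. \<Prod>i\<leftarrow>[s + 2..<n + 1]. f_dag n i ^ a i)"
  let ?t = "Suc s" and ?b = "swap_bits s (s + 1) a"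
  have ket: "ket n c = A c * (f_dag n s ^ c s * (f_dag n ?t ^ c ?t * (B c * I_vac n)))" for c
    unfolding ket_def A_def B_def upt_split_pair[OF assms(1,2)] by (simp add: mult.assoc)
  have r: "s \<in> {1..n}" "?t \<in> {1..n}" "s \<noteq> ?t" using assms by auto
  have AB: "A ?b = A a" "B ?b = B a"
    unfolding A_def B_def by (auto simp: swap_bits_def simp del: upt_Suc intro!: arg_cong[where f = prod_list])
  have vac: "f_op n i * (B a * I_vac n) = 0" if "i \<in> {s, ?t}" for i
  proof -
    have "f_op n i * B a = (- 1) ^ (\<Sum>i\<leftarrow>[s + 2..<n + 1]. a i) * (B a * f_op n i)"
      unfolding B_def
      by (rule anticommute_prod_list_pow, rule f_op_f_dag_anticommute) (use that r in auto)
    then show ?thesis using f_op_I_vac[of i n] that r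
      by (auto simp: mult.assoc simp flip: mult.assoc[of "f_op n i"])
  qed
  have comm: "x * y * A a = A a * (x * y)"
    if "x \<in> {f_op n s, f_dag n s, f_op n ?t, f_dag n ?t}"
      "y \<in> {f_op n s, f_dag n s, f_op n ?t, f_dag n ?t}" for x y
    unfolding A_def
    by (rule commute_prod_list_pow; use that r in \<open>auto intro!: f_op_f_dag_anticommute f_dag_anticommute\<close>)
  have comm4: "x * y * z * w * A a = A a * (x * y * z * w)"
    if "x \<in> {f_op n s, f_dag n s, f_op n ?t, f_dag n ?t}"
      "y \<in> {f_op n s, f_dag n s, f_op n ?t, f_dag n ?t}"
      "z \<in> {f_op n s, f_dag n s, f_op n ?t, f_dag n ?t}"
      "w \<in> {f_op n s, f_dag n s, f_op n ?t, f_dag n ?t}" for x y z w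
    using comm[OF that(1,2)] comm[OF that(3,4)] by (metis mult.assoc)
  have "swap_gate n s * A a = A a * swap_gate n s"
    by (simp add: swap_gate_def algebra_simps comm comm4 flip: mult.assoc)
  then have "swap_gate n s * ket n a
      = A a * (swap_gate n s * (f_dag n s ^ a s * (f_dag n ?t ^ a ?t * (B a * I_vac n))))"
    by (metis ket mult.assoc)
  also have "swap_gate n s * (f_dag n s ^ a s * (f_dag n ?t ^ a ?t * (B a * I_vac n)))
      = f_dag n s ^ a ?t * (f_dag n ?t ^ a s * (B a * I_vac n))"
  proof -
    have bits: "a s \<in> {0, 1}" "a ?t \<in> {0, 1}" using assms by (auto simp: bits_def)
    have gf: "f_op n ?t * f_dag n s = - (f_dag n s * f_op n ?t)"
      using r by (intro f_op_f_dag_anticommute) auto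
    show ?thesis
      unfolding swap_gate_def Suc_eq_plus1[symmetric]
      by (rule two_mode_swap[OF f_dag_square[OF r(1)] f_dag_square[OF r(2)]
            f_op_f_dag_same[OF r(1)] f_op_f_dag_same[OF r(2)] f_op_anticommute[OF r]
            f_dag_anticommute[OF r] f_op_f_dag_anticommute[OF r] gf vac vac bits]) simp_all
  qed
  also have "A a * \<dots> = ket n ?b"
    unfolding ket AB by (simp add: swap_bits_def)
  finally show ?thesis .
qed

section \<open>Closure properties of the quantum register algebra\<close>

abbreviation e_algebra :: "nat \<Rightarrow> clifford set" where
  "e_algebra n \<equiv> generated_algebra (e_gen ` {1..2 * n})"

lemma \<iota>_commute_e_algebra: "x \<in> e_algebra n \<Longrightarrow> x * \<iota> = \<iota> * x"
proof (induction rule: generated_algebra.induct)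
  case (mult x y)
  then show ?case by (metis mult.assoc)
qed (auto simp: \<iota>_commute_e_gen algebra_simps)

lemma e_algebra_zero: "0 \<in> e_algebra n"
  using generated_algebra.scaleR[OF generated_algebra.one, of 0] by simp

lemma QRA_eq: "QRA n = {x + \<iota> * y | x y. x \<in> e_algebra n \<and> y \<in> e_algebra n}"
proof (intro equalityI subsetI)
  fix z assume "z \<in> QRA n"
  then obtain m :: nat and c x where z: "z = (\<Sum>k<m. c k * x k)"
    and cx: "\<forall>k<m. c k \<in> Ctilde \<and> x k \<in> e_algebra n"
    by (auto simp: QRA_def)
  have "(\<Sum>k<m. c k * x k) \<in> {x + \<iota> * y | x y. x \<in> e_algebra n \<and> y \<in> e_algebra n}"
    using cx
  proof (induction m)
    case 0
    then show ?case using e_algebra_zero by force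
  next
    case (Suc m)
    then obtain x' y' where xy: "x' \<in> e_algebra n" "y' \<in> e_algebra n"
      "(\<Sum>k<m. c k * x k) = x' + \<iota> * y'" by auto
    from Suc.prems obtain p q where "c m = of_real p + of_real q * \<iota>" "x m \<in> e_algebra n"
      by (auto simp: Ctilde_def)
    then have "(\<Sum>k<Suc m. c k * x k) = (x' + p *\<^sub>R x m) + \<iota> * (y' + q *\<^sub>R x m)"
      using xy by (simp add: algebra_simps of_real_def)
    then show ?case using xy \<open>x m \<in> e_algebra n\<close>
      by (blast intro: generated_algebra.add generated_algebra.scaleR)
  qed
  then show "z \<in> {x + \<iota> * y | x y. x \<in> e_algebra n \<and> y \<in> e_algebra n}" by (simp add: z)
next
  fix z assume "z \<in> {x + \<iota> * y | x y. x \<in> e_algebra n \<and> y \<in> e_algebra n}"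
  then obtain x y where xy: "z = x + \<iota> * y" "x \<in> e_algebra n" "y \<in> e_algebra n" by blast
  have C: "1 \<in> Ctilde" "\<iota> \<in> Ctilde"
    unfolding Ctilde_def
    by (rule CollectI, rule exI[of _ 1], rule exI[of _ 0], simp)
       (rule CollectI, rule exI[of _ 0], rule exI[of _ 1], simp)
  have "z = (\<Sum>k<2::nat. (if k = 0 then 1 else \<iota>) * (if k = 0 then x else y))"
    using xy by (simp add: numeral_2_eq_2)
  moreover have "\<forall>k<2::nat. (if k = 0 then 1 else \<iota>) \<in> Ctilde \<and> (if k = 0 then x else y) \<in> e_algebra n"
    using xy C by auto
  ultimately show "z \<in> QRA n" unfolding QRA_def by (intro CollectI exI conjI)
qed

lemma QRA_add: "x \<in> QRA n \<Longrightarrow> y \<in> QRA n \<Longrightarrow> x + y \<in> QRA n"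
proof -
  assume "x \<in> QRA n" "y \<in> QRA n"
  then obtain a b c d where "a \<in> e_algebra n" "b \<in> e_algebra n" "c \<in> e_algebra n" "d \<in> e_algebra n"
    "x = a + \<iota> * b" "y = c + \<iota> * d" unfolding QRA_eq by blast
  moreover from this have "x + y = (a + c) + \<iota> * (b + d)" by (simp add: algebra_simps)
  ultimately show ?thesis unfolding QRA_eq by (blast intro: generated_algebra.add)
qed

lemma QRA_scaleR: "x \<in> QRA n \<Longrightarrow> c *\<^sub>R x \<in> QRA n"
proof -
  assume "x \<in> QRA n"
  then obtain a b where "a \<in> e_algebra n" "b \<in> e_algebra n" "x = a + \<iota> * b"
    unfolding QRA_eq by blast
  moreover from this have "c *\<^sub>R x = c *\<^sub>R a + \<iota> * (c *\<^sub>R b)" by (simp add: algebra_simps)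
  ultimately show ?thesis unfolding QRA_eq by (blast intro: generated_algebra.scaleR)
qed

lemma QRA_mult: "x \<in> QRA n \<Longrightarrow> y \<in> QRA n \<Longrightarrow> x * y \<in> QRA n"
proof -
  assume "x \<in> QRA n" "y \<in> QRA n"
  then obtain a b c d where abcd: "a \<in> e_algebra n" "b \<in> e_algebra n" "c \<in> e_algebra n"
    "d \<in> e_algebra n" "x = a + \<iota> * b" "y = c + \<iota> * d" unfolding QRA_eq by blast
  have a: "a * (\<iota> * d) = \<iota> * (a * d)"
    by (metis \<iota>_commute_e_algebra[OF abcd(1)] mult.assoc)
  have b: "\<iota> * (b * (\<iota> * d)) = - (b * d)"
    by (metis \<iota>_commute_e_algebra[OF abcd(2)] \<iota>_square mult.assoc mult_minus1)
  have "x * y = (a * c + (- 1) *\<^sub>R (b * d)) + \<iota> * (a * d + b * c)"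
    by (simp add: abcd(5,6) algebra_simps a b)
  then show ?thesis using abcd unfolding QRA_eq
    by (blast intro: generated_algebra.add generated_algebra.mult generated_algebra.scaleR)
qed

lemma QRA_diff: "x \<in> QRA n \<Longrightarrow> y \<in> QRA n \<Longrightarrow> x - y \<in> QRA n"
  using QRA_add[of x n "- 1 *\<^sub>R y"] QRA_scaleR[of y n "- 1"] by simp

lemma e_algebra_in_QRA: "x \<in> e_algebra n \<Longrightarrow> x \<in> QRA n"
  unfolding QRA_eq using e_algebra_zero by force

lemma QRA_one: "1 \<in> QRA n"
  by (intro e_algebra_in_QRA generated_algebra.one)

lemma \<iota>_in_QRA: "\<iota> \<in> QRA n"
  unfolding QRA_eq using e_algebra_zero generated_algebra.one by force

lemma Ctilde_in_QRA: "c \<in> Ctilde \<Longrightarrow> c \<in> QRA n"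
  unfolding Ctilde_def
  by (auto simp: of_real_def intro!: QRA_add QRA_scaleR QRA_one \<iota>_in_QRA)

lemma QRA_prod_list: "(\<And>i. i \<in> set is \<Longrightarrow> h i \<in> QRA n) \<Longrightarrow> (\<Prod>i\<leftarrow>is. h i) \<in> QRA n"
  by (induction "is") (auto intro: QRA_mult QRA_one)

lemma QRA_sum: "(\<And>i. i \<in> S \<Longrightarrow> h i \<in> QRA n) \<Longrightarrow> sum h S \<in> QRA n"
  using e_algebra_in_QRA[OF e_algebra_zero]
  by (induction S rule: infinite_finite_induct) (auto intro: QRA_add)

lemma QRA_power: "x \<in> QRA n \<Longrightarrow> x ^ k \<in> QRA n"
  by (induction k) (auto intro: QRA_mult QRA_one)

lemma f_op_in_QRA: "i \<in> {1..n} \<Longrightarrow> f_op n i \<in> QRA n"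
  and f_dag_in_QRA: "i \<in> {1..n} \<Longrightarrow> f_dag n i \<in> QRA n"
proof -
  assume "i \<in> {1..n}"
  then have "e_gen i \<in> QRA n" "e_gen (i + n) \<in> QRA n"
    by (auto intro!: e_algebra_in_QRA generated_algebra.base)
  then show "f_op n i \<in> QRA n" "f_dag n i \<in> QRA n"
    unfolding f_op_def f_dag_def
    by (auto intro!: QRA_scaleR QRA_add QRA_diff QRA_mult intro: \<iota>_in_QRA)
qed

lemma ket_in_QRA: "ket n a \<in> QRA n"
  unfolding ket_def I_vac_def
  by (intro QRA_mult QRA_prod_list QRA_power f_op_in_QRA f_dag_in_QRA) auto

lemma swap_gate_in_QRA: "1 \<le> s \<Longrightarrow> s < n \<Longrightarrow> swap_gate n s \<in> QRA n"
  unfolding swap_gate_def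
  by (intro QRA_add QRA_diff QRA_mult f_op_in_QRA f_dag_in_QRA) auto

lemma Ctilde_commute_QRA:
  assumes "c \<in> Ctilde" "x \<in> QRA n"
  shows "x * c = c * x"
proof -
  from assms(2) obtain a b where "a \<in> e_algebra n" "b \<in> e_algebra n" "x = a + \<iota> * b"
    unfolding QRA_eq by blast
  then have "x * \<iota> = \<iota> * x" using \<iota>_commute_e_algebra
    by (simp add: algebra_simps)
  then show ?thesis
    using assms(1) by (auto simp: Ctilde_def of_real_def algebra_simps)
qed

theorem lemma4p1:
  fixes n s :: nat and \<psi> :: clifford
  assumes "n > 0" and "1 \<le> s" and "s < n" and "\<psi> \<in> qubits n"
  shows "swap_gate n s \<in> QRA n \<and>
    \<psi> \<in> QRA n \<and>
    swaps_basis_states n s (s + 1) (swap_gate n s) \<and>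
    acts_as_swap_on n s (s + 1) (swap_gate n s) \<psi>"
proof (intro conjI)
  show gate: "swap_gate n s \<in> QRA n"
    using assms by (intro swap_gate_in_QRA)
  show "\<psi> \<in> QRA n"
    using assms(4) unfolding qubits_def
    by (auto intro!: QRA_sum QRA_mult ket_in_QRA intro: Ctilde_in_QRA)
  show "swaps_basis_states n s (s + 1) (swap_gate n s)"
    unfolding swaps_basis_states_def using assms swap_gate_ket by blast
  show "acts_as_swap_on n s (s + 1) (swap_gate n s) \<psi>"
    unfolding acts_as_swap_on_def
  proof (intro allI impI)
    fix c assume c: "\<forall>a\<in>bits n. c a \<in> Ctilde" and \<psi>: "\<psi> = (\<Sum>a\<in>bits n. c a * ket n a)"
    have "swap_gate n s * (c a * ket n a) = c a * ket n (swap_bits s (s + 1) a)"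
      if "a \<in> bits n" for a
      by (metis Ctilde_commute_QRA assms(2,3) c gate mult.assoc swap_gate_ket that)
    then show "swap_gate n s * \<psi> = (\<Sum>a\<in>bits n. c a * ket n (swap_bits s (s + 1) a))"
      by (simp add: \<psi> sum_distrib_left)
  qed
qed

end
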